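(* Let $\mathbf Z=G_z(\boldsymbol\theta_0,\mathbf U)$, let $T:\mathcal U\times\Theta\to\mathcal T\subseteq\mathbb R^q$ be a nuclear mapping, let $B_\alpha(\boldsymbol\theta)$ ($0<\alpha<1$, $\boldsymbol\theta\in\Theta$) be Borel sets, and let $$\Gamma_\alpha(\mathbf z)=\{\boldsymbol\theta\in\Theta:\ \exists\,\mathbf u^*\in\mathcal U\text{ such that }\mathbf z=G_z(\boldsymbol\theta,\mathbf u^* ),\ T(\mathbf u^*,\boldsymbol\theta)\in B_\alpha(\boldsymbol\theta)\}.$$ (i) If $\mathbb P\{T(\mathbf U,\boldsymbol\theta)\in B_\alpha(\boldsymbol\theta)\}\ge\alpha$ for every $\boldsymbol\theta\in\Theta$, then $\mathbb P\{\boldsymbol\theta_0\in\Gamma_\alpha(\mathbf Z)\}\ge\alpha$ for $0<\alpha<1$. (ii) If instead the inequality holds only approximately, in the sense that $\mathbb P\{T(\mathbf U,\boldsymbol\theta)\in B_\alpha(\boldsymbol\theta)\}\ge\alpha\{1+o(\delta')\}$ for every $\boldsymbol\theta\in\Theta$, then $\mathbb P\{\boldsymbol\theta_0\in\Gamma_\alpha(\mathbf Z)\}\ge\alpha\{1+o(\delta')\}$ for $0<\alpha<1$.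
   Context: $\Theta$ is an arbitrary parameter set (possibly discrete or non-numerical) and $\boldsymbol\theta_0\in\Theta$ is the true parameter. $\mathbf U$ is a random vector with values in $\mathcal U\subset\mathbb R^r$ whose distribution is known and free of $\boldsymbol\theta_0$. $G_z:\Theta\times\mathcal U\to\mathcal Z\subset\mathbb R^m$ is a known mapping. Measurability of the events whose probabilities are taken is implicit. $\delta'>0$ is a small value which may depend on the sample size $n$; $o(\delta')$ denotes a quantity which, divided by $\delta'$, tends to $0$ as $\delta'\to0$. *)

theory Defs
  imports "HOL-Probability.Probability" "HOL-Library.Landau_Symbols"
begin

text \<open>
  Euclidean d-space with its Borel sigma-algebra. The dimension is a term, not a type, because in
  an asymptotic setting the dimensions of the random vectors may grow with the sample size.
\<close>
abbreviation vec_borel :: "nat \<Rightarrow> (nat \<Rightarrow> real) measure" where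
  "vec_borel d \<equiv> Pi\<^sub>M {..<d} (\<lambda>_. borel)"

text \<open>The set \<open>\<Gamma>\<^sub>\<alpha>(z)\<close>, where \<open>B\<close> stands for the family \<open>B\<^sub>\<alpha>\<close> at a fixed level \<open>\<alpha>\<close>.\<close>
definition repro_set ::
  "'p set \<Rightarrow> 'u set \<Rightarrow> ('p \<Rightarrow> 'u \<Rightarrow> 'z) \<Rightarrow> ('u \<Rightarrow> 'p \<Rightarrow> 't) \<Rightarrow> ('p \<Rightarrow> 't set) \<Rightarrow> 'z \<Rightarrow> 'p set"
  where "repro_set \<Theta> \<U> G T B z = {\<theta> \<in> \<Theta>. \<exists>u\<in>\<U>. z = G \<theta> u \<and> T u \<theta> \<in> B \<theta>}"

text \<open>
  A nuclear mapping \<open>T\<close> is any mapping from \<open>\<U> \<times> \<Theta>\<close> into a subset of a Euclidean space. Neither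
  \<open>M\<close> nor \<open>U\<close> takes a parameter argument: the law of \<open>U\<close> is free of \<open>\<theta>\<^sub>0\<close>. The last two assumptions
  are the implicit measurability of the events whose probabilities are taken; they are genuine
  assumptions, since neither \<open>G\<close> nor \<open>T\<close> is required to be measurable.
\<close>
locale repro_model = prob_space M
  for M :: "'w measure" +
  fixes r m q :: nat
    and \<U> \<Z> \<T> :: "(nat \<Rightarrow> real) set"
    and \<Theta> :: "'p set"
    and \<theta>\<^sub>0 :: 'p
    and U :: "'w \<Rightarrow> (nat \<Rightarrow> real)"
    and G :: "'p \<Rightarrow> (nat \<Rightarrow> real) \<Rightarrow> (nat \<Rightarrow> real)"
    and T :: "(nat \<Rightarrow> real) \<Rightarrow> 'p \<Rightarrow> (nat \<Rightarrow> real)"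
    and B :: "real \<Rightarrow> 'p \<Rightarrow> (nat \<Rightarrow> real) set"
  assumes U_subset: "\<U> \<subseteq> space (vec_borel r)"
    and Z_subset: "\<Z> \<subseteq> space (vec_borel m)"
    and T_subset: "\<T> \<subseteq> space (vec_borel q)"
    and true_parameter: "\<theta>\<^sub>0 \<in> \<Theta>"
    and U_measurable: "U \<in> measurable M (vec_borel r)"
    and U_values: "\<And>\<omega>. \<omega> \<in> space M \<Longrightarrow> U \<omega> \<in> \<U>"
    and G_values: "\<And>\<theta> u. \<theta> \<in> \<Theta> \<Longrightarrow> u \<in> \<U> \<Longrightarrow> G \<theta> u \<in> \<Z>"
    and T_values: "\<And>u \<theta>. u \<in> \<U> \<Longrightarrow> \<theta> \<in> \<Theta> \<Longrightarrow> T u \<theta> \<in> \<T>"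
    and B_borel: "\<And>\<alpha> \<theta>. 0 < \<alpha> \<Longrightarrow> \<alpha> < 1 \<Longrightarrow> \<theta> \<in> \<Theta> \<Longrightarrow> B \<alpha> \<theta> \<in> sets (vec_borel q)"
    and nuclear_event: "\<And>\<alpha> \<theta>. 0 < \<alpha> \<Longrightarrow> \<alpha> < 1 \<Longrightarrow> \<theta> \<in> \<Theta> \<Longrightarrow>
          {\<omega> \<in> space M. T (U \<omega>) \<theta> \<in> B \<alpha> \<theta>} \<in> sets M"
    and coverage_event: "\<And>\<alpha>. 0 < \<alpha> \<Longrightarrow> \<alpha> < 1 \<Longrightarrow>
          {\<omega> \<in> space M. \<theta>\<^sub>0 \<in> repro_set \<Theta> \<U> G T (B \<alpha>) (G \<theta>\<^sub>0 (U \<omega>))} \<in> sets M"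

end

theory Submission imports Defs begin

text \<open>
  If \<open>T(U, \<theta>\<^sub>0)\<close> lies in \<open>B\<^sub>\<alpha>(\<theta>\<^sub>0)\<close>, then \<open>U\<close> itself is a witness \<open>u\<^sup>*\<close> putting \<open>\<theta>\<^sub>0\<close> into
  \<open>\<Gamma>\<^sub>\<alpha>(Z)\<close>. Hence the coverage probability dominates the nuclear probability at \<open>\<theta>\<^sub>0\<close>, and any
  lower bound for the latter, exact or approximate, is inherited.
\<close>

lemma (in repro_model) nuclear_prob_le_coverage_prob:
  assumes "0 < \<alpha>" "\<alpha> < 1"
  shows "prob {\<omega> \<in> space M. T (U \<omega>) \<theta>\<^sub>0 \<in> B \<alpha> \<theta>\<^sub>0}
           \<le> prob {\<omega> \<in> space M. \<theta>\<^sub>0 \<in> repro_set \<Theta> \<U> G T (B \<alpha>) (G \<theta>\<^sub>0 (U \<omega>))}"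
proof (rule finite_measure_mono)
  show "{\<omega> \<in> space M. T (U \<omega>) \<theta>\<^sub>0 \<in> B \<alpha> \<theta>\<^sub>0}
          \<subseteq> {\<omega> \<in> space M. \<theta>\<^sub>0 \<in> repro_set \<Theta> \<U> G T (B \<alpha>) (G \<theta>\<^sub>0 (U \<omega>))}"
    using true_parameter U_values unfolding repro_set_def by blast
\<comment> \<open>Monotonicity needs the larger event to be measurable: a non-measurable set has
  measure 0 by default, which would break the inequality.\<close>
qed (rule coverage_event[OF assms])

text \<open>A remainder o(\<delta>') makes no sense for a single model. Hence a family of models
  indexed by \<open>i\<close>, sharing \<open>\<Theta>\<close> and \<open>\<theta>\<^sub>0\<close>,
  with the limit taken along an arbitrary filter \<open>F\<close>.\<close>

theorem theorem1:
  fixes M :: "'i \<Rightarrow> 'w measure"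
    and r m q :: "'i \<Rightarrow> nat"
    and \<U> \<Z> \<T> :: "'i \<Rightarrow> (nat \<Rightarrow> real) set"
    and \<Theta> :: "'p set"
    and \<theta>\<^sub>0 :: 'p
    and U :: "'i \<Rightarrow> 'w \<Rightarrow> (nat \<Rightarrow> real)"
    and G :: "'i \<Rightarrow> 'p \<Rightarrow> (nat \<Rightarrow> real) \<Rightarrow> (nat \<Rightarrow> real)"
    and T :: "'i \<Rightarrow> (nat \<Rightarrow> real) \<Rightarrow> 'p \<Rightarrow> (nat \<Rightarrow> real)"
    and B :: "'i \<Rightarrow> real \<Rightarrow> 'p \<Rightarrow> (nat \<Rightarrow> real) set"
    and Z :: "'i \<Rightarrow> 'w \<Rightarrow> (nat \<Rightarrow> real)"
    and \<Gamma> :: "'i \<Rightarrow> real \<Rightarrow> (nat \<Rightarrow> real) \<Rightarrow> 'p set"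
  assumes model: "\<And>i. repro_model (M i) (r i) (m i) (q i) (\<U> i) (\<Z> i) (\<T> i) \<Theta> \<theta>\<^sub>0
                        (U i) (G i) (T i) (B i)"
    and Z: "\<And>i \<omega>. Z i \<omega> = G i \<theta>\<^sub>0 (U i \<omega>)"
    and \<Gamma>: "\<And>i \<alpha> z. \<Gamma> i \<alpha> z = repro_set \<Theta> (\<U> i) (G i) (T i) (B i \<alpha>) z"
  shows
    "(\<forall>i \<alpha>. 0 < \<alpha> \<longrightarrow> \<alpha> < 1 \<longrightarrow>
        (\<forall>\<theta>\<in>\<Theta>. measure (M i) {\<omega> \<in> space (M i). T i (U i \<omega>) \<theta> \<in> B i \<alpha> \<theta>} \<ge> \<alpha>) \<longrightarrow>
        measure (M i) {\<omega> \<in> space (M i). \<theta>\<^sub>0 \<in> \<Gamma> i \<alpha> (Z i \<omega>)} \<ge> \<alpha>)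
     \<and>
     (\<forall>(F :: 'i filter) (\<delta>' :: 'i \<Rightarrow> real) \<alpha>.
        (\<forall>i. \<delta>' i > 0) \<longrightarrow> (\<delta>' \<longlongrightarrow> 0) F \<longrightarrow> 0 < \<alpha> \<longrightarrow> \<alpha> < 1 \<longrightarrow>
        (\<forall>\<theta>\<in>\<Theta>. \<exists>\<epsilon> \<in> o[F](\<delta>'). \<forall>i.
            measure (M i) {\<omega> \<in> space (M i). T i (U i \<omega>) \<theta> \<in> B i \<alpha> \<theta>} \<ge> \<alpha> * (1 + \<epsilon> i)) \<longrightarrow>
        (\<exists>\<epsilon> \<in> o[F](\<delta>'). \<forall>i.
            measure (M i) {\<omega> \<in> space (M i). \<theta>\<^sub>0 \<in> \<Gamma> i \<alpha> (Z i \<omega>)} \<ge> \<alpha> * (1 + \<epsilon> i)))"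
proof -
  have \<theta>\<^sub>0: "\<theta>\<^sub>0 \<in> \<Theta>"
    using model by (rule repro_model.true_parameter)
  have coverage: "measure (M i) {\<omega> \<in> space (M i). T i (U i \<omega>) \<theta>\<^sub>0 \<in> B i \<alpha> \<theta>\<^sub>0}
      \<le> measure (M i) {\<omega> \<in> space (M i). \<theta>\<^sub>0 \<in> \<Gamma> i \<alpha> (Z i \<omega>)}"
    if "0 < \<alpha>" "\<alpha> < 1" for i \<alpha>
    using repro_model.nuclear_prob_le_coverage_prob[OF model that] by (simp only: Z \<Gamma>)
  show ?thesis
    \<comment> \<open>Both parts specialise the hypothesis to \<theta> =
      \<open>\<theta>\<^sub>0\<close> and chain it with \<open>coverage\<close>. In the second, the
      remainder \<epsilon> obtained at \<open>\<theta>\<^sub>0\<close> is itself the witness, so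
      remainders may vary with \<theta>.\<close>
    using \<theta>\<^sub>0 by (blast intro: order_trans[OF _ coverage])
qed

end
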